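(* Let $G$ be a group and let $X$ be an infinite transitive $G$-space. For an infinite subset $A$ of $X$, the following statements are equivalent: (i) $Gp$ is discrete for each $p\in A^*$; (ii) $A$ contains no piecewise shifted $FP$-sets.
   Context: $X$ is endowed with the discrete topology; $\beta X$ is its Stone–Čech compactification, i.e. the set of ultrafilters on $X$ with base of open sets $\overline{A}=\{p\in\beta X: A\in p\}$, $A\subseteq X$; points of $X$ are identified with principal ultrafilters, $X^*=\beta X\setminus X$ and $A^*=\overline{A}\cap X^*$. For $g\in G$ and $p\in\beta X$, $gp=\{gP:P\in p\}$; $Gp=\{gp:g\in G\}$ has the subspace topology from $\beta X$. A subset $Y$ of $X$ is a piecewise shifted $FP$-set if there exist a sequence $(g_n)_{n\in\omega}$ in $G$ and a sequence $(x_n)_{n\in\omega}$ in $X$ such that (1) $\{g_0^{\varepsilon_0}\cdots g_n^{\varepsilon_n}x_n:\varepsilon_i\in\{0,1\}\}\cap\{g_0^{\varepsilon_0}\cdots g_m^{\varepsilon_m}x_m:\varepsilon_i\in\{0,1\}\}=\varnothing$ for all distinct $m,n\in\omega$; (2) $|\{g_0^{\varepsilon_0}\cdots g_n^{\varepsilon_n}x_n:\varepsilon_i\in\{0,1\}\}|=2^{n+1}$ for every $n\in\omega$; and $Y=\{g_0^{\varepsilon_0}\cdots g_n^{\varepsilon_n}x_n:\varepsilon_i\in\{0,1\},\ n\in\omega\}$. *)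

theory Defs
  imports "HOL-Analysis.Analysis" "HOL-Algebra.Group_Action"
begin

definition ultrafilter_on :: "'x set \<Rightarrow> 'x set set \<Rightarrow> bool" where
  "ultrafilter_on X p \<longleftrightarrow>
     p \<subseteq> Pow X \<and> X \<in> p \<and> {} \<notin> p \<and>
     (\<forall>P\<in>p. \<forall>Q\<in>p. P \<inter> Q \<in> p) \<and>
     (\<forall>P\<in>p. \<forall>Q. P \<subseteq> Q \<and> Q \<subseteq> X \<longrightarrow> Q \<in> p) \<and>
     (\<forall>P. P \<subseteq> X \<longrightarrow> P \<in> p \<or> X - P \<in> p)"

definition principal_ultrafilter :: "'x set \<Rightarrow> 'x \<Rightarrow> 'x set set" where
  "principal_ultrafilter X x = {P. P \<subseteq> X \<and> x \<in> P}"

definition sc_points :: "'x set \<Rightarrow> 'x set set set" where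
  "sc_points X = {p. ultrafilter_on X p}"

definition sc_basic :: "'x set \<Rightarrow> 'x set \<Rightarrow> 'x set set set" where
  "sc_basic X A = {p \<in> sc_points X. A \<in> p}"

text \<open>The Stone-Cech compactification of the discrete space \<open>X\<close>. The generating family is
  closed under finite intersections, so it is a base; see \<open>openin_stone_cech_iff\<close>.\<close>

definition stone_cech :: "'x set \<Rightarrow> 'x set set topology" where
  "stone_cech X = topology_generated_by {sc_basic X A | A. A \<subseteq> X}"

lemma topspace_stone_cech: "topspace (stone_cech X) = sc_points X"
proof -
  have "sc_basic X X = sc_points X"
    by (auto simp: sc_basic_def sc_points_def ultrafilter_on_def)
  then show ?thesis
    unfolding stone_cech_def topology_generated_by_topspace
    by (auto simp: sc_basic_def)
qed

lemma sc_basic_Int: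
  assumes "A \<subseteq> X" "B \<subseteq> X"
  shows "sc_basic X A \<inter> sc_basic X B = sc_basic X (A \<inter> B)"
proof -
  have "A \<inter> B \<in> p \<longleftrightarrow> A \<in> p \<and> B \<in> p" if "ultrafilter_on X p" for p
  proof
    assume "A \<inter> B \<in> p"
    moreover have "\<forall>P\<in>p. \<forall>Q. P \<subseteq> Q \<and> Q \<subseteq> X \<longrightarrow> Q \<in> p"
      using that by (simp add: ultrafilter_on_def)
    ultimately show "A \<in> p \<and> B \<in> p"
      using assms by (meson Int_lower1 Int_lower2)
  next
    assume "A \<in> p \<and> B \<in> p"
    then show "A \<inter> B \<in> p"
      using that by (simp add: ultrafilter_on_def)
  qed
  then show ?thesis
    by (auto simp: sc_basic_def sc_points_def)
qed

lemma openin_stone_cech_iff: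
  "openin (stone_cech X) U \<longleftrightarrow>
     U \<subseteq> sc_points X \<and> (\<forall>p\<in>U. \<exists>A\<subseteq>X. p \<in> sc_basic X A \<and> sc_basic X A \<subseteq> U)"
  (is "_ \<longleftrightarrow> ?R U")
proof
  assume U: "openin (stone_cech X) U"
  then have "generate_topology_on {sc_basic X A | A. A \<subseteq> X} U"
    by (simp add: stone_cech_def openin_topology_generated_by_iff)
  then have "\<forall>p\<in>U. \<exists>A\<subseteq>X. p \<in> sc_basic X A \<and> sc_basic X A \<subseteq> U"
  proof induction
    case (Int a b)
    show ?case
    proof
      fix p assume "p \<in> a \<inter> b"
      with Int.IH obtain A B where "A \<subseteq> X" "p \<in> sc_basic X A" "sc_basic X A \<subseteq> a"
        "B \<subseteq> X" "p \<in> sc_basic X B" "sc_basic X B \<subseteq> b"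
        by blast
      then have "A \<inter> B \<subseteq> X \<and> p \<in> sc_basic X (A \<inter> B) \<and> sc_basic X (A \<inter> B) \<subseteq> a \<inter> b"
        using sc_basic_Int[of A X B] by blast
      then show "\<exists>A\<subseteq>X. p \<in> sc_basic X A \<and> sc_basic X A \<subseteq> a \<inter> b"
        by blast
    qed
  next
    case (UN K)
    show ?case
    proof
      fix p assume "p \<in> \<Union> K"
      then obtain k where k: "k \<in> K" "p \<in> k" by blast
      with UN.IH obtain A where "A \<subseteq> X" "p \<in> sc_basic X A" "sc_basic X A \<subseteq> k"
        by blast
      with k show "\<exists>A\<subseteq>X. p \<in> sc_basic X A \<and> sc_basic X A \<subseteq> \<Union> K"
        by blast
    qed
  qed auto
  with openin_subset[OF U] show "?R U"
    by (simp add: topspace_stone_cech)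
next
  assume R: "?R U"
  have "openin (stone_cech X) (sc_basic X A)" if "A \<subseteq> X" for A
    unfolding stone_cech_def by (rule topology_generated_by_Basis) (use that in blast)
  with R show "openin (stone_cech X) U"
    by (subst openin_subopen) blast
qed

definition sc_remainder :: "'x set \<Rightarrow> 'x set set set" where
  "sc_remainder X = sc_points X - principal_ultrafilter X ` X"

definition sc_star :: "'x set \<Rightarrow> 'x set \<Rightarrow> 'x set set set" where
  "sc_star X A = sc_basic X A \<inter> sc_remainder X"

definition sc_action :: "('g \<Rightarrow> 'x \<Rightarrow> 'x) \<Rightarrow> 'g \<Rightarrow> 'x set set \<Rightarrow> 'x set set" where
  "sc_action \<phi> g p = {\<phi> g ` P | P. P \<in> p}"

definition discrete_subspace :: "'a topology \<Rightarrow> 'a set \<Rightarrow> bool" where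
  "discrete_subspace T S \<longleftrightarrow> S \<subseteq> topspace T \<and> subtopology T S = discrete_topology S"

text \<open>The ordered product \<open>g\<^sub>0\<^bsup>\<epsilon>\<^sub>0\<^esup> \<cdots> g\<^sub>n\<^bsup>\<epsilon>\<^sub>n\<^esup>\<close>; the group need not be commutative.\<close>

primrec ordered_prod ::
    "('g, 'm) monoid_scheme \<Rightarrow> (nat \<Rightarrow> 'g) \<Rightarrow> (nat \<Rightarrow> nat) \<Rightarrow> nat \<Rightarrow> 'g" where
  "ordered_prod G g \<epsilon> 0 = g 0 [^]\<^bsub>G\<^esub> \<epsilon> 0"
| "ordered_prod G g \<epsilon> (Suc n) = ordered_prod G g \<epsilon> n \<otimes>\<^bsub>G\<^esub> (g (Suc n) [^]\<^bsub>G\<^esub> \<epsilon> (Suc n))"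

definition shifted_FP_block ::
    "('g, 'm) monoid_scheme \<Rightarrow> ('g \<Rightarrow> 'x \<Rightarrow> 'x) \<Rightarrow> (nat \<Rightarrow> 'g) \<Rightarrow> (nat \<Rightarrow> 'x) \<Rightarrow> nat \<Rightarrow> 'x set" where
  "shifted_FP_block G \<phi> g x n =
     {\<phi> (ordered_prod G g \<epsilon> n) (x n) | \<epsilon>. \<forall>i\<le>n. \<epsilon> i \<in> {0, 1}}"

definition piecewise_shifted_FP_set ::
    "('g, 'm) monoid_scheme \<Rightarrow> 'x set \<Rightarrow> ('g \<Rightarrow> 'x \<Rightarrow> 'x) \<Rightarrow> 'x set \<Rightarrow> bool" where
  "piecewise_shifted_FP_set G X \<phi> Y \<longleftrightarrow>
     (\<exists>g x. range g \<subseteq> carrier G \<and> range x \<subseteq> X \<and>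
        (\<forall>m n. m \<noteq> n \<longrightarrow> shifted_FP_block G \<phi> g x m \<inter> shifted_FP_block G \<phi> g x n = {}) \<and>
        (\<forall>n. card (shifted_FP_block G \<phi> g x n) = 2 ^ (n + 1)) \<and>
        Y = (\<Union>n. shifted_FP_block G \<phi> g x n))"

end

theory Submission
  imports Defs
begin

text \<open>
  By homogeneity, \<open>G p\<close> fails to be discrete exactly when \<open>p\<close> is a limit of points \<open>g p \<noteq> p\<close>, that
  is, when every \<open>P \<in> p\<close> belongs to some \<open>g p \<noteq> p\<close> (\<open>discrete_orbit_iff_isolated\<close>). Both
  implications are proved by contraposition, through this recurrence property.

  If \<open>p \<in> A\<^sup>*\<close> is recurrent in this sense, then every \<open>Q \<in> p\<close> contains, for some \<open>P \<in> p\<close> and \<open>g\<close>,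
  two disjoint copies \<open>P\<close> and \<open>g P\<close> (\<open>splitting_if_not_isolated\<close>). Iterating this inside \<open>A\<close>, and
  removing one point at each stage, gives a Cantor scheme, in which different exponents lead to
  different points. The removed points and the shifts of the scheme are the sequences \<open>x\<close> and \<open>g\<close>
  of a piecewise shifted FP-set (\<open>piecewise_shifted_FP_set_if_nested\<close>).

  Conversely, let such a set be given by \<open>g\<close> and \<open>x\<close>. Its \<open>m\<close>-th tail consists of the points
  of the blocks from the \<open>m\<close>-th on whose first \<open>m\<close> exponents vanish, and the \<open>m\<close>-th set of shifts
  consists of the nonempty products of generators of index at least \<open>m\<close>. Such a shift maps some
  later tail into the \<open>m\<close>-th tail but off that later tail. Hence the ultrafilters containing all
  tails form a compact set which the limits of ever later shifts do not leave, while no single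
  shift fixes a point of it. These limits compose like the elements of a closed semigroup, so a
  minimal nonempty closed invariant subset consists of points that are limits of their own shifts
  (\<open>recurrent_point_exists\<close>), and the orbit of such a point is not discrete. This replaces the usual
  appeal to an idempotent of \<open>\<beta>G\<close>.
\<close>

section \<open>Ultrafilters and the compactness of the Stone-Cech compactification\<close>

context
  fixes X :: "'x set" and p :: "'x set set"
  assumes p: "ultrafilter_on X p"
begin

lemma ultrafilter_subset: "P \<in> p \<Longrightarrow> P \<subseteq> X"
  and ultrafilter_space: "X \<in> p"
  and ultrafilter_nonempty: "P \<in> p \<Longrightarrow> P \<noteq> {}"
  and ultrafilter_Int: "P \<in> p \<Longrightarrow> Q \<in> p \<Longrightarrow> P \<inter> Q \<in> p"
  and ultrafilter_mono: "P \<in> p \<Longrightarrow> P \<subseteq> Q \<Longrightarrow> Q \<subseteq> X \<Longrightarrow> Q \<in> p"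
  using p by (auto simp: ultrafilter_on_def)

lemma ultrafilter_Diff_iff:
  assumes "P \<subseteq> X"
  shows "X - P \<in> p \<longleftrightarrow> P \<notin> p"
proof
  show "P \<notin> p" if "X - P \<in> p"
    using ultrafilter_Int[OF that] ultrafilter_nonempty by fastforce
  show "X - P \<in> p" if "P \<notin> p"
    using p assms that unfolding ultrafilter_on_def by metis
qed

lemma ultrafilter_disjoint: "P \<in> p \<Longrightarrow> Q \<in> p \<Longrightarrow> P \<inter> Q \<noteq> {}"
  using ultrafilter_Int ultrafilter_nonempty by blast

lemma nonprincipal_ultrafilter_Diff_singleton:
  assumes "p \<notin> principal_ultrafilter X ` X" and "P \<in> p"
  shows "P - {x} \<in> p"
proof (cases "x \<in> X")
  case True
  have "{x} \<notin> p"
  proof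
    assume "{x} \<in> p"
    then have "p = principal_ultrafilter X x"
      using ultrafilter_disjoint[of "{x}"] ultrafilter_mono[of "{x}"] ultrafilter_subset
      unfolding principal_ultrafilter_def by blast
    then show False
      using assms(1) True by blast
  qed
  then have "X - {x} \<in> p"
    using ultrafilter_Diff_iff True by blast
  then have "P \<inter> (X - {x}) \<in> p"
    using ultrafilter_Int assms(2) by blast
  moreover have "P \<inter> (X - {x}) = P - {x}"
    using ultrafilter_subset[OF assms(2)] by blast
  ultimately show ?thesis
    by simp
next
  case False
  then show ?thesis
    using assms(2) ultrafilter_subset[OF assms(2)] by (metis Diff_insert0 Diff_empty subsetD)
qed

end

lemma ultrafilter_eqI:
  assumes p: "ultrafilter_on X p" and q: "ultrafilter_on X q" and "p \<subseteq> q"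
  shows "p = q"
proof -
  have "P \<in> p" if "P \<in> q" for P
  proof -
    have PX: "P \<subseteq> X"
      using ultrafilter_subset[OF q that] .
    have "X - P \<notin> q"
      using ultrafilter_Diff_iff[OF q PX] that by simp
    then show ?thesis
      using ultrafilter_Diff_iff[OF p PX] \<open>p \<subseteq> q\<close> by blast
  qed
  then show ?thesis
    using \<open>p \<subseteq> q\<close> by blast
qed

lemma ultrafilter_on_principal: "x \<in> X \<Longrightarrow> ultrafilter_on X (principal_ultrafilter X x)"
  unfolding ultrafilter_on_def principal_ultrafilter_def by auto

text \<open>The ultrafilter is a maximal family with the finite intersection property: by maximality a
  set belongs to it as soon as it meets all finite intersections, and a set and its complement
  cannot both fail to do so.\<close>

lemma ultrafilter_extension:
  assumes "F \<subseteq> Pow X" and fip: "\<And>S. finite S \<Longrightarrow> S \<subseteq> F \<Longrightarrow> X \<inter> \<Inter>S \<noteq> {}"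
  obtains p where "ultrafilter_on X p" and "F \<subseteq> p"
proof -
  define \<A> where
    "\<A> = {M. F \<subseteq> M \<and> M \<subseteq> Pow X \<and> (\<forall>S. finite S \<longrightarrow> S \<subseteq> M \<longrightarrow> X \<inter> \<Inter>S \<noteq> {})}"
  have "F \<in> \<A>"
    using assms unfolding \<A>_def by blast
  have "\<exists>M\<in>\<A>. \<forall>N\<in>\<A>. M \<subseteq> N \<longrightarrow> N = M"
  proof (rule subset_Zorn_nonempty)
    show "\<A> \<noteq> {}"
      using \<open>F \<in> \<A>\<close> by blast
  next
    fix \<C> assume ne: "\<C> \<noteq> {}" and chain: "subset.chain \<A> \<C>"
    have sub: "\<C> \<subseteq> \<A>"
      using chain by (simp add: subset_chain_def)
    have "X \<inter> \<Inter>S \<noteq> {}" if S: "finite S" "S \<subseteq> \<Union>\<C>" for S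
    proof -
      obtain M where "M \<in> \<C>" "S \<subseteq> M"
        using finite_subset_Union_chain[OF S ne chain] by metis
      moreover from this have "M \<in> \<A>"
        using sub by blast
      ultimately show ?thesis
        using S(1) by (simp add: \<A>_def)
    qed
    moreover have "F \<subseteq> M \<and> M \<subseteq> Pow X" if "M \<in> \<C>" for M
      using subsetD[OF sub that] by (simp add: \<A>_def)
    then have "F \<subseteq> \<Union>\<C>" "\<Union>\<C> \<subseteq> Pow X"
      using ne by blast+
    ultimately show "\<Union>\<C> \<in> \<A>"
      by (simp add: \<A>_def)
  qed
  then obtain M where M: "M \<in> \<A>" and max: "\<And>N. N \<in> \<A> \<Longrightarrow> M \<subseteq> N \<Longrightarrow> N = M"
    by blast
  have fipM: "X \<inter> \<Inter>S \<noteq> {}" if "finite S" "S \<subseteq> M" for S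
    using M that by (simp add: \<A>_def)
  have MX: "M \<subseteq> Pow X" and FM: "F \<subseteq> M"
    using M by (simp_all add: \<A>_def)
  have mem: "Q \<in> M" if "Q \<subseteq> X" and meet: "\<And>S. finite S \<Longrightarrow> S \<subseteq> M \<Longrightarrow> X \<inter> \<Inter>S \<inter> Q \<noteq> {}" for Q
  proof -
    have "X \<inter> \<Inter>S \<noteq> {}" if "finite S" "S \<subseteq> insert Q M" for S
      using meet[of "S - {Q}"] that by fastforce
    then have "insert Q M \<in> \<A>"
      using MX FM \<open>Q \<subseteq> X\<close> by (simp add: \<A>_def subset_insertI2)
    then show ?thesis
      using max by blast
  qed
  have above: "Q \<in> M" if S: "finite S" "S \<subseteq> M" "X \<inter> \<Inter>S \<subseteq> Q" and "Q \<subseteq> X" for S Q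
  proof (rule mem)
    fix S' assume "finite S'" "S' \<subseteq> M"
    then have "X \<inter> \<Inter>(S \<union> S') \<noteq> {}"
      using S by (intro fipM) auto
    then show "X \<inter> \<Inter>S' \<inter> Q \<noteq> {}"
      using S by blast
  qed fact
  have "ultrafilter_on X M"
    unfolding ultrafilter_on_def
  proof (intro conjI ballI allI impI)
    show "M \<subseteq> Pow X" by (fact MX)
    show "X \<in> M" using above[of "{}" X] by simp
    show "{} \<notin> M" using fipM[of "{{}}"] by auto
    show "P \<inter> Q \<in> M" if "P \<in> M" "Q \<in> M" for P Q
      using above[of "{P, Q}" "P \<inter> Q"] that MX by auto
    show "Q \<in> M" if "P \<in> M" "P \<subseteq> Q \<and> Q \<subseteq> X" for P Q
      using above[of "{P}" Q] that by auto
    show "P \<in> M \<or> X - P \<in> M" if PX: "P \<subseteq> X" for P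
    proof (rule ccontr)
      assume "\<not> (P \<in> M \<or> X - P \<in> M)"
      then obtain S S' where S: "finite S" "S \<subseteq> M" "X \<inter> \<Inter>S \<inter> P = {}"
        and S': "finite S'" "S' \<subseteq> M" "X \<inter> \<Inter>S' \<inter> (X - P) = {}"
        using mem[OF PX] mem[OF Diff_subset] by metis
      have "X \<inter> \<Inter>(S \<union> S') \<noteq> {}"
        using S S' by (intro fipM) auto
      then show False
        using S(3) S'(3) by blast
    qed
  qed
  then show ?thesis
    using that FM by blast
qed

lemma openin_sc_basic: "A \<subseteq> X \<Longrightarrow> openin (stone_cech X) (sc_basic X A)"
  unfolding openin_stone_cech_iff by (auto simp: sc_basic_def)

lemma closedin_sc_basic:
  assumes "A \<subseteq> X"
  shows "closedin (stone_cech X) (sc_basic X A)"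
proof -
  have "sc_points X - sc_basic X A = sc_basic X (X - A)"
    using ultrafilter_Diff_iff[OF _ assms] by (auto simp: sc_basic_def sc_points_def)
  then show ?thesis
    unfolding closedin_def topspace_stone_cech
    using openin_sc_basic[of "X - A" X] by (auto simp: sc_basic_def)
qed

text \<open>If no finite subfamily covers, the complements of the sets \<open>A\<close> whose basic sets lie inside
  a member of the cover have the finite intersection property; an ultrafilter containing them
  all would be a point missed by the cover.\<close>

lemma compact_space_stone_cech: "compact_space (stone_cech X)"
  unfolding compact_space
proof (intro allI impI, elim conjE)
  fix \<U> assume op: "Ball \<U> (openin (stone_cech X))" and cov: "\<Union>\<U> = topspace (stone_cech X)"
  define F where "F = {X - A | A. A \<subseteq> X \<and> (\<exists>U\<in>\<U>. sc_basic X A \<subseteq> U)}"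
  show "\<exists>\<F>. finite \<F> \<and> \<F> \<subseteq> \<U> \<and> \<Union>\<F> = topspace (stone_cech X)"
  proof (cases "\<forall>S. finite S \<longrightarrow> S \<subseteq> F \<longrightarrow> X \<inter> \<Inter>S \<noteq> {}")
    case True
    have "F \<subseteq> Pow X"
      unfolding F_def by blast
    with True obtain p where p: "ultrafilter_on X p" "F \<subseteq> p"
      using ultrafilter_extension[of F X] by metis
    then obtain U where U: "U \<in> \<U>" "p \<in> U"
      using cov unfolding topspace_stone_cech sc_points_def by blast
    moreover have "openin (stone_cech X) U"
      using op U(1) by blast
    ultimately obtain A where A: "A \<subseteq> X" "p \<in> sc_basic X A" "sc_basic X A \<subseteq> U"
      unfolding openin_stone_cech_iff by blast
    then have "X - A \<in> p"
      using p(2) U(1) unfolding F_def by blast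
    then show ?thesis
      using A ultrafilter_Diff_iff[OF p(1)] unfolding sc_basic_def by blast
  next
    case False
    then obtain S where S: "finite S" "S \<subseteq> F" "X \<inter> \<Inter>S = {}"
      by blast
    have "\<forall>B\<in>S. \<exists>U\<in>\<U>. \<forall>p. ultrafilter_on X p \<longrightarrow> B \<notin> p \<longrightarrow> p \<in> U"
    proof
      fix B assume "B \<in> S"
      then have "B \<in> F"
        using S(2) by blast
      then obtain A U where AU: "B = X - A" "A \<subseteq> X" "U \<in> \<U>" "sc_basic X A \<subseteq> U"
        unfolding F_def by blast
      have "p \<in> U" if "ultrafilter_on X p" "B \<notin> p" for p
        using ultrafilter_Diff_iff[OF that(1) AU(2)] that AU(1,4)
        by (auto simp: sc_basic_def sc_points_def)
      then show "\<exists>U\<in>\<U>. \<forall>p. ultrafilter_on X p \<longrightarrow> B \<notin> p \<longrightarrow> p \<in> U"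
        using AU by blast
    qed
    then obtain u where u: "\<And>B. B \<in> S \<Longrightarrow> u B \<in> \<U>"
      "\<And>B p. B \<in> S \<Longrightarrow> ultrafilter_on X p \<Longrightarrow> B \<notin> p \<Longrightarrow> p \<in> u B"
      by metis
    have "p \<in> \<Union>(u ` S)" if p: "ultrafilter_on X p" for p
    proof (rule ccontr)
      assume "p \<notin> \<Union>(u ` S)"
      then have "S \<subseteq> p"
        using u(2) p by blast
      with S(1) have "X \<inter> \<Inter>S \<in> p"
      proof (induction S)
        case empty
        then show ?case using ultrafilter_space[OF p] by simp
      next
        case (insert B S)
        then show ?case
          using ultrafilter_Int[OF p, of B "X \<inter> \<Inter>S"] by (simp add: Int_left_commute)
      qed
      then show False
        using S(3) ultrafilter_nonempty[OF p] by metis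
    qed
    then have "\<Union>(u ` S) = topspace (stone_cech X)"
      using u(1) cov unfolding topspace_stone_cech sc_points_def by blast
    then show ?thesis
      using S(1) u(1) by blast
  qed
qed

lemma in_closure_of_stone_cech:
  assumes "S \<subseteq> sc_points X"
  shows "p \<in> stone_cech X closure_of S \<longleftrightarrow> p \<in> sc_points X \<and> (\<forall>P\<in>p. \<exists>q\<in>S. P \<in> q)"
    (is "_ \<longleftrightarrow> _ \<and> ?R")
proof (cases "p \<in> sc_points X")
  case p: True
  have "(\<forall>T. p \<in> T \<and> openin (stone_cech X) T \<longrightarrow> (\<exists>q. q \<in> S \<and> q \<in> T)) \<longleftrightarrow> ?R"
  proof (intro iffI ballI allI impI)
    fix P assume H: "\<forall>T. p \<in> T \<and> openin (stone_cech X) T \<longrightarrow> (\<exists>q. q \<in> S \<and> q \<in> T)" and P: "P \<in> p"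
    have "P \<subseteq> X"
      using p ultrafilter_subset[OF _ P] by (simp add: sc_points_def)
    then have "openin (stone_cech X) (sc_basic X P)" "p \<in> sc_basic X P"
      using openin_sc_basic p P by (simp_all add: sc_basic_def)
    then have "\<exists>q. q \<in> S \<and> q \<in> sc_basic X P"
      using H by blast
    then show "\<exists>q\<in>S. P \<in> q"
      unfolding sc_basic_def by blast
  next
    fix T assume ?R and T: "p \<in> T \<and> openin (stone_cech X) T"
    then obtain P where P: "p \<in> sc_basic X P" "sc_basic X P \<subseteq> T"
      unfolding openin_stone_cech_iff by blast
    then obtain q where "q \<in> S" "P \<in> q"
      using \<open>?R\<close> unfolding sc_basic_def by blast
    then show "\<exists>q. q \<in> S \<and> q \<in> T"
      using P assms unfolding sc_basic_def by blast
  qed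
  then show ?thesis
    using p by (simp add: in_closure_of topspace_stone_cech)
qed (simp add: in_closure_of topspace_stone_cech)

section \<open>Recurrent points in compact spaces\<close>

text \<open>Think of \<open>\<Phi> p\<close> as the limit set of \<open>p\<close> under a dynamical system. Zorn's lemma, applied to
  complements, gives a minimal nonempty closed set containing the limit sets of its points. For
  a point \<open>p\<close> of it, transitivity makes \<open>\<Phi> p\<close> such a set too; by minimality the two sets are
  equal, so \<open>p\<close> is a limit of itself.\<close>

lemma recurrent_point_exists:
  assumes T: "compact_space T" and K: "closedin T K" "K \<noteq> {}"
    and closed: "\<And>p. p \<in> K \<Longrightarrow> closedin T (\<Phi> p)"
    and ne: "\<And>p. p \<in> K \<Longrightarrow> \<Phi> p \<noteq> {}"
    and sub: "\<And>p. p \<in> K \<Longrightarrow> \<Phi> p \<subseteq> K"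
    and trans: "\<And>p q. p \<in> K \<Longrightarrow> q \<in> \<Phi> p \<Longrightarrow> \<Phi> q \<subseteq> \<Phi> p"
  obtains p where "p \<in> K" and "p \<in> \<Phi> p"
proof -
  define \<A> where "\<A> = {U. openin T U \<and> K - U \<noteq> {} \<and> (\<forall>p\<in>K - U. \<Phi> p \<inter> U = {})}"
  have "\<exists>M\<in>\<A>. \<forall>N\<in>\<A>. M \<subseteq> N \<longrightarrow> N = M"
  proof (rule subset_Zorn_nonempty)
    have "{} \<in> \<A>"
      using K unfolding \<A>_def by simp
    then show "\<A> \<noteq> {}"
      by blast
  next
    fix \<C> assume C: "\<C> \<noteq> {}" and chain: "subset.chain \<A> \<C>"
    have sub: "\<C> \<subseteq> \<A>"
      using chain by (simp add: subset_chain_def)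
    have C_D: "openin T U" "\<not> K \<subseteq> U" "\<And>p. p \<in> K \<Longrightarrow> p \<notin> U \<Longrightarrow> \<Phi> p \<inter> U = {}" if "U \<in> \<C>" for U
      using subsetD[OF sub that] by (auto simp: \<A>_def)
    have "K - \<Union>\<C> \<noteq> {}"
    proof
      assume "K - \<Union>\<C> = {}"
      then have cover: "K \<subseteq> \<Union>\<C>"
        by blast
      have "compactin T K"
        using closedin_compact_space T K(1) by blast
      from compactinD[OF this C_D(1) cover]
      obtain \<F> where \<F>: "finite \<F>" "\<F> \<subseteq> \<C>" "K \<subseteq> \<Union>\<F>"
        by metis
      have "\<F> \<noteq> {}"
        using \<F>(3) K(2) by blast
      moreover have "subset.chain \<A> \<F>"
        using chain \<F>(2) unfolding subset_chain_def by (metis subset_trans subsetD)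
      ultimately have "\<Union>\<F> \<in> \<C>"
        using Union_in_chain[OF \<F>(1)] \<F>(2) by blast
      then show False
        using \<F>(3) C_D(2) by blast
    qed
    moreover have "openin T (\<Union>\<C>)"
      using C_D(1) by (intro openin_Union) blast
    moreover have "\<Phi> p \<inter> \<Union>\<C> = {}" if "p \<in> K - \<Union>\<C>" for p
      using C_D(3) that by blast
    ultimately show "\<Union>\<C> \<in> \<A>"
      by (simp add: \<A>_def)
  qed
  then obtain M where M: "M \<in> \<A>" and max: "\<And>N. N \<in> \<A> \<Longrightarrow> M \<subseteq> N \<Longrightarrow> N = M"
    by blast
  then obtain p where p: "p \<in> K" "p \<notin> M" "\<Phi> p \<inter> M = {}"
    unfolding \<A>_def by blast
  have "K - (topspace T - \<Phi> p) = \<Phi> p"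
    using sub[OF p(1)] closedin_subset[OF K(1)] by blast
  then have "topspace T - \<Phi> p \<in> \<A>"
    using closed[OF p(1)] ne[OF p(1)] trans[OF p(1)] unfolding \<A>_def by auto
  moreover have "M \<subseteq> topspace T - \<Phi> p"
    using M p(3) openin_subset unfolding \<A>_def by blast
  ultimately have "topspace T - \<Phi> p = M"
    using max by blast
  then have "p \<in> \<Phi> p"
    using p closedin_subset[OF K(1)] by blast
  with p(1) that show ?thesis
    by blast
qed

section \<open>The induced action on ultrafilters\<close>

context group_action
begin

lemma group_G: "group G"
  using group_hom group_hom_def by blast

lemma action_one: "x \<in> E \<Longrightarrow> \<phi> \<one> x = x"
  using id_eq_one by (metis restrict_apply')

lemma action_inv: "g \<in> carrier G \<Longrightarrow> x \<in> E \<Longrightarrow> \<phi> (inv g) (\<phi> g x) = x"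
  using orbit_sym_aux by blast

text \<open>Membership in \<open>g p\<close> is most convenient in terms of preimages.\<close>

lemma mem_sc_action_iff:
  assumes p: "ultrafilter_on E p" and g: "g \<in> carrier G"
  shows "S \<in> sc_action \<phi> g p \<longleftrightarrow> S \<subseteq> E \<and> {x \<in> E. \<phi> g x \<in> S} \<in> p"
proof
  assume "S \<in> sc_action \<phi> g p"
  then obtain P where P: "S = \<phi> g ` P" "P \<in> p"
    unfolding sc_action_def by blast
  have "P \<subseteq> E"
    using ultrafilter_subset[OF p P(2)] .
  then have "S \<subseteq> E" "P \<subseteq> {x \<in> E. \<phi> g x \<in> S}"
    using P(1) surj_prop[OF g] by blast+
  then show "S \<subseteq> E \<and> {x \<in> E. \<phi> g x \<in> S} \<in> p"
    using ultrafilter_mono[OF p P(2)] by auto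
next
  assume S: "S \<subseteq> E \<and> {x \<in> E. \<phi> g x \<in> S} \<in> p"
  then have "S \<subseteq> \<phi> g ` E"
    using surj_prop[OF g] by simp
  then have "\<phi> g ` {x \<in> E. \<phi> g x \<in> S} = S"
    by blast
  then show "S \<in> sc_action \<phi> g p"
    using S unfolding sc_action_def by blast
qed

lemma ultrafilter_on_sc_action:
  assumes p: "ultrafilter_on E p" and g: "g \<in> carrier G"
  shows "ultrafilter_on E (sc_action \<phi> g p)"
proof -
  have maps: "\<phi> g x \<in> E" if "x \<in> E" for x
    using surj_prop[OF g] that by blast
  note mem = mem_sc_action_iff[OF p g]
  have "{x \<in> E. \<phi> g x \<in> P \<inter> Q} = {x \<in> E. \<phi> g x \<in> P} \<inter> {x \<in> E. \<phi> g x \<in> Q}" for P Q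
    by blast
  moreover have "{x \<in> E. \<phi> g x \<in> E - P} = E - {x \<in> E. \<phi> g x \<in> P}" for P
    using maps by blast
  moreover have "{x \<in> E. \<phi> g x \<in> E} = E"
    using maps by blast
  moreover have "{x \<in> E. \<phi> g x \<in> Q} \<in> p" if "{x \<in> E. \<phi> g x \<in> P} \<in> p" "P \<subseteq> Q" for P Q
    using ultrafilter_mono[OF p that(1), of "{x \<in> E. \<phi> g x \<in> Q}"] that(2) by blast
  moreover have "{x \<in> E. \<phi> g x \<in> {}} \<notin> p"
    using ultrafilter_nonempty[OF p] by blast
  ultimately show ?thesis
    unfolding ultrafilter_on_def mem
    using ultrafilter_Int[OF p] ultrafilter_space[OF p] ultrafilter_Diff_iff[OF p]
    by (auto simp: mem)
qed

lemma sc_action_eq_image: "sc_action \<phi> g p = (`) (\<phi> g) ` p"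
  by (simp add: sc_action_def Setcompr_eq_image)

lemma sc_action_mult:
  assumes p: "ultrafilter_on E p" and g: "g \<in> carrier G" and h: "h \<in> carrier G"
  shows "sc_action \<phi> (g \<otimes> h) p = sc_action \<phi> g (sc_action \<phi> h p)"
proof -
  have "\<phi> (g \<otimes> h) ` P = \<phi> g ` \<phi> h ` P" if "P \<in> p" for P
    unfolding image_image
    using composition_rule[OF subsetD[OF ultrafilter_subset[OF p that]] g h]
    by (rule image_cong[OF refl])
  then show ?thesis
    unfolding sc_action_eq_image image_image[of "(`) (\<phi> g)"] by (rule image_cong[OF refl])
qed

lemma sc_action_one:
  assumes p: "ultrafilter_on E p"
  shows "sc_action \<phi> \<one> p = p"
proof -
  have "\<phi> \<one> ` P = P" if "P \<in> p" for P
    using action_one subsetD[OF ultrafilter_subset[OF p that]] by (simp add: image_cong[of P P "\<phi> \<one>" id])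
  then show ?thesis
    unfolding sc_action_eq_image by simp
qed

text \<open>By homogeneity an orbit is discrete as soon as one of its points is isolated in it: if \<open>P\<close>
  isolates \<open>p\<close>, then \<open>g P\<close> isolates \<open>g p\<close>.\<close>

lemma discrete_orbit_iff_isolated:
  assumes p: "ultrafilter_on E p"
  shows "discrete_subspace (stone_cech E) (orbit G (sc_action \<phi>) p) \<longleftrightarrow>
    (\<exists>P\<in>p. \<forall>g\<in>carrier G. P \<in> sc_action \<phi> g p \<longrightarrow> sc_action \<phi> g p = p)"
    (is "discrete_subspace _ ?O \<longleftrightarrow> ?R")
proof -
  interpret group G by (rule group_G)
  have sub: "?O \<subseteq> topspace (stone_cech E)"
    using ultrafilter_on_sc_action[OF p]
    unfolding orbit_def topspace_stone_cech sc_points_def by blast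
  have eq: "discrete_subspace (stone_cech E) ?O \<longleftrightarrow>
      (\<forall>q\<in>?O. openin (subtopology (stone_cech E) ?O) {q})"
    unfolding discrete_subspace_def eq_commute[of "subtopology _ _"] discrete_topology_unique
    using sub by auto
  have "p \<in> ?O"
    using sc_action_one[OF p] unfolding orbit_def by force
  show ?thesis
  proof
    assume "discrete_subspace (stone_cech E) ?O"
    then obtain U where U: "openin (stone_cech E) U" "{p} = U \<inter> ?O"
      using eq \<open>p \<in> ?O\<close> unfolding openin_subtopology by blast
    then obtain P where P: "P \<in> p" "sc_basic E P \<subseteq> U"
      unfolding openin_stone_cech_iff sc_basic_def by blast
    have "sc_action \<phi> g p = p" if "g \<in> carrier G" "P \<in> sc_action \<phi> g p" for g
    proof -
      have "sc_action \<phi> g p \<in> U \<inter> ?O"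
        using that P(2) ultrafilter_on_sc_action[OF p]
        unfolding sc_basic_def sc_points_def orbit_def by blast
      then show ?thesis
        using U(2) by blast
    qed
    then show ?R
      using P(1) by blast
  next
    assume ?R
    then obtain P where P: "P \<in> p"
      "\<And>g. g \<in> carrier G \<Longrightarrow> P \<in> sc_action \<phi> g p \<Longrightarrow> sc_action \<phi> g p = p"
      by blast
    have PE: "P \<subseteq> E"
      using ultrafilter_subset[OF p P(1)] .
    have "openin (subtopology (stone_cech E) ?O) {q}" if "q \<in> ?O" for q
    proof -
      obtain g where g: "g \<in> carrier G" "q = sc_action \<phi> g p"
        using \<open>q \<in> ?O\<close> unfolding orbit_def by blast
      have gP: "\<phi> g ` P \<in> q"
        using g P(1) unfolding sc_action_def by blast
      have gPE: "\<phi> g ` P \<subseteq> E"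
        using PE surj_prop[OF g(1)] by blast
      have "r = q" if r: "r \<in> ?O" "\<phi> g ` P \<in> r" for r
      proof -
        obtain h where h: "h \<in> carrier G" "r = sc_action \<phi> h p"
          using r(1) unfolding orbit_def by blast
        have "\<phi> (inv g) ` \<phi> g ` P \<in> sc_action \<phi> (inv g) r"
          using r(2) unfolding sc_action_def by blast
        moreover have "\<phi> (inv g) ` \<phi> g ` P = P"
          using action_inv[OF g(1)] PE by force
        ultimately have "P \<in> sc_action \<phi> (inv g \<otimes> h) p"
          using sc_action_mult[OF p] g(1) h by simp
        then have "sc_action \<phi> (inv g \<otimes> h) p = p"
          using P(2) g(1) h(1) by simp
        then have "q = sc_action \<phi> (g \<otimes> (inv g \<otimes> h)) p"
          using sc_action_mult[OF p g(1)] g h(1) by simp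
        also have "g \<otimes> (inv g \<otimes> h) = h"
          using g(1) h(1) by (simp add: m_assoc[symmetric])
        finally show "r = q"
          using h(2) by simp
      qed
      then have "{q} = sc_basic E (\<phi> g ` P) \<inter> ?O"
        using \<open>q \<in> ?O\<close> gP sub unfolding sc_basic_def topspace_stone_cech by blast
      then show ?thesis
        unfolding openin_subtopology using openin_sc_basic[OF gPE] by blast
    qed
    then show "discrete_subspace (stone_cech E) ?O"
      using eq by blast
  qed
qed

section \<open>Ordered products\<close>

lemma ordered_prod_cong:
  "(\<And>i. i \<le> n \<Longrightarrow> \<epsilon> i = \<delta> i) \<Longrightarrow> ordered_prod G g \<epsilon> n = ordered_prod G g \<delta> n"
  by (induction n) auto

lemma ordered_prod_closed:
  assumes "range g \<subseteq> carrier G"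
  shows "ordered_prod G g \<epsilon> n \<in> carrier G"
proof -
  interpret group G by (rule group_G)
  show ?thesis
    using assms by (induction n) (auto simp: subset_iff)
qed

lemma ordered_prod_eq_one:
  assumes "\<And>i. i \<le> n \<Longrightarrow> \<epsilon> i = 0"
  shows "ordered_prod G g \<epsilon> n = \<one>"
proof -
  interpret group G by (rule group_G)
  show ?thesis
    using assms by (induction n) auto
qed

lemma ordered_prod_mult:
  assumes g: "range g \<subseteq> carrier G" and "l \<le> n" and \<delta>: "\<And>i. i \<le> l \<Longrightarrow> \<delta> i = 0"
  shows "ordered_prod G g \<epsilon> l \<otimes> ordered_prod G g \<delta> n =
    ordered_prod G g (\<lambda>i. if i \<le> l then \<epsilon> i else \<delta> i) n"
proof -
  interpret group G by (rule group_G)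
  have gc: "g i \<in> carrier G" for i
    using g by blast
  show ?thesis
    using \<open>l \<le> n\<close>
  proof (induction n rule: dec_induct)
    case base
    have "ordered_prod G g \<delta> l = \<one>"
      using \<delta> ordered_prod_eq_one by blast
    then show ?case
      using ordered_prod_closed[OF g]
      by (simp add: ordered_prod_cong[of l "\<lambda>i. if i \<le> l then \<epsilon> i else \<delta> i" \<epsilon>])
  next
    case (step n)
    then show ?case
      using ordered_prod_closed[OF g] gc by (simp add: m_assoc[symmetric])
  qed
qed

section \<open>From a piecewise shifted FP-set to an orbit that is not discrete\<close>

lemma shifted_FP_block_eq_image:
  "shifted_FP_block G \<phi> g x n =
    (\<lambda>\<epsilon>. \<phi> (ordered_prod G g \<epsilon> n) (x n)) ` ({..n} \<rightarrow>\<^sub>E {0, 1})"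
proof -
  have "\<phi> (ordered_prod G g \<epsilon> n) (x n) \<in>
      (\<lambda>\<epsilon>. \<phi> (ordered_prod G g \<epsilon> n) (x n)) ` ({..n} \<rightarrow>\<^sub>E {0, 1})"
    if "\<forall>i\<le>n. \<epsilon> i \<in> {0, 1}" for \<epsilon>
  proof (rule image_eqI)
    show "restrict \<epsilon> {..n} \<in> {..n} \<rightarrow>\<^sub>E {0, 1}"
      using that by auto
    show "\<phi> (ordered_prod G g \<epsilon> n) (x n) = \<phi> (ordered_prod G g (restrict \<epsilon> {..n}) n) (x n)"
      by (simp add: ordered_prod_cong[of n "restrict \<epsilon> {..n}" \<epsilon>])
  qed
  then show ?thesis
    unfolding shifted_FP_block_def by (auto simp: PiE_iff)
qed

lemma card_binary_words: "card ({..n::nat} \<rightarrow>\<^sub>E {0, 1::nat}) = 2 ^ (n + 1)"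
  by (simp add: card_PiE numeral_2_eq_2)

end

locale shifted_FP_system = group_action G E \<phi> for G (structure) and E \<phi> +
  fixes g :: "nat \<Rightarrow> 'a" and x :: "nat \<Rightarrow> 'b"
  assumes g: "range g \<subseteq> carrier G" and x: "range x \<subseteq> E"
    and blocks_disjoint:
      "m \<noteq> n \<Longrightarrow> shifted_FP_block G \<phi> g x m \<inter> shifted_FP_block G \<phi> g x n = {}"
    and card_block: "card (shifted_FP_block G \<phi> g x n) = 2 ^ (n + 1)"
begin

abbreviation "word \<equiv> ordered_prod G g"

text \<open>The exponents of all tails and shifts range over \<open>binary\<close> sequences; the parameter records how
  many leading exponents are zero.\<close>

definition binary :: "nat \<Rightarrow> (nat \<Rightarrow> nat) \<Rightarrow> bool" where
  "binary m \<epsilon> \<longleftrightarrow> (\<forall>i. \<epsilon> i \<in> {0, 1}) \<and> (\<forall>i<m. \<epsilon> i = 0)"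

definition tail :: "nat \<Rightarrow> 'b set" where
  "tail m = {\<phi> (word \<epsilon> n) (x n) | \<epsilon> n. binary m \<epsilon> \<and> m \<le> n}"

definition shifts :: "nat \<Rightarrow> 'a set" where
  "shifts m = {word \<epsilon> l | \<epsilon> l. binary m \<epsilon> \<and> (\<exists>i\<le>l. \<epsilon> i = 1)}"

lemma binary_antimono: "m \<le> n \<Longrightarrow> binary n \<epsilon> \<Longrightarrow> binary m \<epsilon>"
  unfolding binary_def by simp

lemma binary_one_le: "binary m \<epsilon> \<Longrightarrow> i \<le> l \<Longrightarrow> \<epsilon> i = 1 \<Longrightarrow> m \<le> l"
  unfolding binary_def by (cases "i < m") auto

lemma word_carrier: "word \<epsilon> n \<in> carrier G"
  by (rule ordered_prod_closed[OF g])

lemma x_in: "x n \<in> E"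
  using x by blast

lemma block_memI: "binary m \<epsilon> \<Longrightarrow> \<phi> (word \<epsilon> n) (x n) \<in> shifted_FP_block G \<phi> g x n"
  unfolding shifted_FP_block_def binary_def by blast

text \<open>Disjointness of the blocks and their maximal cardinality together say that a point of the
  system determines both its block and its exponents.\<close>

lemma address_unique:
  assumes "binary k \<epsilon>" "binary l \<delta>" and eq: "\<phi> (word \<epsilon> n) (x n) = \<phi> (word \<delta> m) (x m)"
  shows "n = m" and "i \<le> n \<Longrightarrow> \<epsilon> i = \<delta> i"
proof -
  show nm: "n = m"
    using blocks_disjoint[of n m] block_memI[OF assms(1), of n] block_memI[OF assms(2), of m] eq
    by fastforce
  assume i: "i \<le> n"
  have "inj_on (\<lambda>\<epsilon>. \<phi> (word \<epsilon> n) (x n)) ({..n} \<rightarrow>\<^sub>E {0, 1})"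
    using card_block[of n] unfolding shifted_FP_block_eq_image card_binary_words[symmetric]
    by (intro eq_card_imp_inj_on) (auto intro: finite_PiE)
  moreover have "\<phi> (word (restrict \<epsilon> {..n}) n) (x n) = \<phi> (word (restrict \<delta> {..n}) n) (x n)"
    using eq nm ordered_prod_cong[of n "restrict \<epsilon> {..n}" \<epsilon> g]
      ordered_prod_cong[of n "restrict \<delta> {..n}" \<delta> g] by simp
  moreover have "restrict \<epsilon> {..n} \<in> {..n} \<rightarrow>\<^sub>E {0, 1}" "restrict \<delta> {..n} \<in> {..n} \<rightarrow>\<^sub>E {0, 1}"
    using assms(1,2) unfolding binary_def by auto
  ultimately have "restrict \<epsilon> {..n} = restrict \<delta> {..n}"
    by (rule inj_onD)
  then show "\<epsilon> i = \<delta> i"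
    using i by (metis atMost_iff restrict_apply')
qed

lemma tail_subset: "tail m \<subseteq> E"
  unfolding tail_def using word_carrier x_in element_image by blast

lemma tail_antimono: "m \<le> n \<Longrightarrow> tail n \<subseteq> tail m"
  unfolding tail_def using binary_antimono order_trans by blast

lemma tail_nonempty: "tail m \<noteq> {}"
proof -
  have "binary m (\<lambda>i. 0)"
    unfolding binary_def by simp
  then show ?thesis
    unfolding tail_def by blast
qed

text \<open>The blocks are pairwise disjoint and the \<open>m\<close>-th tail avoids the first \<open>m\<close> of them.\<close>

lemma Inter_tail: "(\<Inter>m. tail m) = {}"
proof -
  have False if y: "\<forall>m. y \<in> tail m" for y
  proof -
    obtain \<epsilon> n where "y = \<phi> (word \<epsilon> n) (x n)" "binary 0 \<epsilon>"
      using y unfolding tail_def by blast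
    moreover obtain \<delta> m where "y = \<phi> (word \<delta> m) (x m)" "binary (Suc n) \<delta>" "Suc n \<le> m"
      using y unfolding tail_def by blast
    ultimately show False
      using address_unique(1) by fastforce
  qed
  then show ?thesis
    by blast
qed

lemma tail_0_subset: "tail 0 \<subseteq> (\<Union>n. shifted_FP_block G \<phi> g x n)"
  unfolding tail_def using block_memI by blast

lemma shifts_antimono: "m \<le> n \<Longrightarrow> shifts n \<subseteq> shifts m"
  unfolding shifts_def using binary_antimono by blast

lemma shifts_subset: "shifts m \<subseteq> carrier G"
  unfolding shifts_def using word_carrier by blast

lemma shifts_nonempty: "shifts m \<noteq> {}"
proof -
  let ?\<epsilon> = "\<lambda>i. if i = m then 1 else 0 :: nat"
  have "binary m ?\<epsilon>" "\<exists>i\<le>m. ?\<epsilon> i = 1"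
    unfolding binary_def by auto
  then have "word ?\<epsilon> m \<in> shifts m"
    unfolding shifts_def by blast
  then show ?thesis
    by blast
qed

lemma shifts_mult:
  assumes "h \<in> shifts m"
  obtains l where "\<And>k. k \<in> shifts l \<Longrightarrow> h \<otimes> k \<in> shifts m"
proof -
  obtain \<epsilon> l where h: "h = word \<epsilon> l" "binary m \<epsilon>" "\<exists>i\<le>l. \<epsilon> i = 1"
    using assms unfolding shifts_def by blast
  have "m \<le> l"
    using binary_one_le h by blast
  show ?thesis
  proof (rule that)
    fix k assume "k \<in> shifts (Suc l)"
    then obtain \<delta> n where k: "k = word \<delta> n" "binary (Suc l) \<delta>" "\<exists>i\<le>n. \<delta> i = 1"
      unfolding shifts_def by blast
    \<comment> \<open>\<open>\<delta>\<close> vanishes up to \<open>l\<close>, so the two words do not overlap and can be concatenated.\<close>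
    define \<gamma> where "\<gamma> = (\<lambda>i. if i \<le> l then \<epsilon> i else \<delta> i)"
    have "l \<le> n"
      using binary_one_le[OF k(2)] k(3) Suc_leD by blast
    moreover have "h \<otimes> k = word \<gamma> n"
      unfolding h(1) k(1) \<gamma>_def
      by (rule ordered_prod_mult[OF g \<open>l \<le> n\<close>]) (use k(2) in \<open>simp add: binary_def\<close>)
    moreover have "binary m \<gamma>"
      using h(2) k(2) \<open>m \<le> l\<close> unfolding binary_def \<gamma>_def by simp
    moreover have "\<exists>i\<le>n. \<gamma> i = 1"
      using h(3) \<open>l \<le> n\<close> unfolding \<gamma>_def by (metis order_trans)
    ultimately show "h \<otimes> k \<in> shifts m"
      unfolding shifts_def by blast
  qed
qed

text \<open>A shift changes the address of every point of a sufficiently late tail, because it writes a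
  nonzero exponent where all the points of that tail have exponent zero.\<close>

lemma shifts_tail:
  assumes "h \<in> shifts m"
  obtains l where "\<phi> h ` tail l \<subseteq> tail m" and "\<phi> h ` tail l \<inter> tail l = {}"
proof -
  obtain \<epsilon> l i where h: "h = word \<epsilon> l" "binary m \<epsilon>" "i \<le> l" "\<epsilon> i = 1"
    using assms unfolding shifts_def by blast
  have "m \<le> l"
    using binary_one_le h by blast
  have *: "\<exists>\<gamma> n. \<phi> h y = \<phi> (word \<gamma> n) (x n) \<and> binary m \<gamma> \<and> \<gamma> i = 1 \<and> Suc l \<le> n"
    if y: "y \<in> tail (Suc l)" for y
  proof -
    obtain \<delta> n where d: "y = \<phi> (word \<delta> n) (x n)" "binary (Suc l) \<delta>" "Suc l \<le> n"
      using y unfolding tail_def by blast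
    define \<gamma> where "\<gamma> = (\<lambda>i. if i \<le> l then \<epsilon> i else \<delta> i)"
    have "\<phi> h y = \<phi> (h \<otimes> word \<delta> n) (x n)"
      using composition_rule[OF x_in] word_carrier h(1) d(1) by simp
    also have "h \<otimes> word \<delta> n = word \<gamma> n"
      unfolding h(1) \<gamma>_def
      by (rule ordered_prod_mult[OF g]) (use d in \<open>auto simp: binary_def\<close>)
    finally have "\<phi> h y = \<phi> (word \<gamma> n) (x n)" .
    moreover have "binary m \<gamma>" "\<gamma> i = 1"
      using h d(2) \<open>m \<le> l\<close> unfolding binary_def \<gamma>_def by auto
    ultimately show ?thesis
      using d(3) by blast
  qed
  show ?thesis
  proof (rule that)
    show "\<phi> h ` tail (Suc l) \<subseteq> tail m"
    proof (rule image_subsetI)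
      fix y assume "y \<in> tail (Suc l)"
      then show "\<phi> h y \<in> tail m"
        using * \<open>m \<le> l\<close> unfolding tail_def by fastforce
    qed
    have False if y: "y \<in> tail (Suc l)" and hy: "\<phi> h y \<in> tail (Suc l)" for y
    proof -
      obtain \<gamma> n where 1: "\<phi> h y = \<phi> (word \<gamma> n) (x n)" "binary m \<gamma>" "\<gamma> i = 1" "Suc l \<le> n"
        using *[OF y] by blast
      obtain \<delta> k where 2: "\<phi> h y = \<phi> (word \<delta> k) (x k)" "binary (Suc l) \<delta>" "Suc l \<le> k"
        using hy unfolding tail_def by blast
      have "\<gamma> i = \<delta> i"
        using address_unique(2)[OF 1(2) 2(2), of n k i] 1 2 h(3) by simp
      then show False
        using 1(3) 2(2) h(3) unfolding binary_def by simp
    qed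
    then show "\<phi> h ` tail (Suc l) \<inter> tail (Suc l) = {}"
      by blast
  qed
qed

definition tail_ultrafilters :: "'b set set set" where
  "tail_ultrafilters = (\<Inter>m. sc_basic E (tail m))"

text \<open>With \<open>\<beta>G\<close> acting on \<open>\<beta>X\<close>, this is the image of \<open>p\<close> under the semigroup of those
  ultrafilters on \<open>G\<close> which contain all sets \<open>shifts m\<close>.\<close>

definition limit_set :: "'b set set \<Rightarrow> 'b set set set" where
  "limit_set p = (\<Inter>m. stone_cech E closure_of ((\<lambda>h. sc_action \<phi> h p) ` shifts m))"

lemma mem_limit_set_iff:
  assumes p: "ultrafilter_on E p"
  shows "q \<in> limit_set p \<longleftrightarrow>
    ultrafilter_on E q \<and> (\<forall>m. \<forall>P\<in>q. \<exists>h\<in>shifts m. P \<in> sc_action \<phi> h p)"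
proof -
  have "(\<lambda>h. sc_action \<phi> h p) ` shifts m \<subseteq> sc_points E" for m
    using ultrafilter_on_sc_action[OF p] shifts_subset unfolding sc_points_def by blast
  note cl = in_closure_of_stone_cech[OF this]
  show ?thesis
    unfolding limit_set_def by (auto simp: cl sc_points_def)
qed

lemma tail_ultrafiltersD:
  assumes "p \<in> tail_ultrafilters"
  shows "ultrafilter_on E p" and "tail m \<in> p"
  using assms unfolding tail_ultrafilters_def sc_basic_def sc_points_def by auto

lemma tail_ultrafilters_nonempty: "tail_ultrafilters \<noteq> {}"
  unfolding tail_ultrafilters_def
proof (rule compact_space_imp_nest[OF compact_space_stone_cech])
  fix m
  show "closedin (stone_cech E) (sc_basic E (tail m))"
    by (rule closedin_sc_basic[OF tail_subset])
  obtain y where "y \<in> tail m"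
    using tail_nonempty by blast
  then have "principal_ultrafilter E y \<in> sc_basic E (tail m)"
    using ultrafilter_on_principal[of y E] tail_subset
    unfolding sc_basic_def sc_points_def principal_ultrafilter_def by blast
  then show "sc_basic E (tail m) \<noteq> {}"
    by blast
next
  show "decseq (\<lambda>m. sc_basic E (tail m))"
    unfolding decseq_def sc_basic_def sc_points_def
    using ultrafilter_mono tail_antimono tail_subset by blast
qed

lemma limit_set_nonempty:
  assumes p: "ultrafilter_on E p"
  shows "limit_set p \<noteq> {}"
  unfolding limit_set_def
proof (rule compact_space_imp_nest[OF compact_space_stone_cech])
  fix m
  have sub: "(\<lambda>h. sc_action \<phi> h p) ` shifts m \<subseteq> topspace (stone_cech E)"
    using ultrafilter_on_sc_action[OF p] shifts_subset
    unfolding sc_points_def topspace_stone_cech by blast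
  show "stone_cech E closure_of ((\<lambda>h. sc_action \<phi> h p) ` shifts m) \<noteq> {}"
    using closure_of_subset[OF sub] shifts_nonempty[of m] by blast
next
  show "decseq (\<lambda>m. stone_cech E closure_of ((\<lambda>h. sc_action \<phi> h p) ` shifts m))"
    unfolding decseq_def using shifts_antimono by (intro allI impI closure_of_mono image_mono)
qed (rule closedin_closure_of)

lemma limit_set_subset:
  assumes p: "p \<in> tail_ultrafilters"
  shows "limit_set p \<subseteq> tail_ultrafilters"
proof
  note up = tail_ultrafiltersD(1)[OF p]
  fix q assume "q \<in> limit_set p"
  then have q: "ultrafilter_on E q" "\<And>m P. P \<in> q \<Longrightarrow> \<exists>h\<in>shifts m. P \<in> sc_action \<phi> h p"
    using mem_limit_set_iff[OF up] by blast+
  have "tail m \<in> q" for m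
  proof (rule ccontr)
    assume "tail m \<notin> q"
    then have "E - tail m \<in> q"
      using ultrafilter_Diff_iff[OF q(1) tail_subset] by blast
    then obtain h where h: "h \<in> shifts m" "E - tail m \<in> sc_action \<phi> h p"
      using q(2) by blast
    obtain l where "\<phi> h ` tail l \<subseteq> tail m" "\<phi> h ` tail l \<inter> tail l = {}"
      by (rule shifts_tail[OF h(1)])
    then have "\<phi> h ` tail l \<inter> (E - tail m) = {}"
      by blast
    moreover have "\<phi> h ` tail l \<in> sc_action \<phi> h p"
      using tail_ultrafiltersD(2)[OF p] unfolding sc_action_def by blast
    moreover have "ultrafilter_on E (sc_action \<phi> h p)"
      using ultrafilter_on_sc_action[OF up] h(1) shifts_subset by blast
    ultimately show False
      using ultrafilter_disjoint h(2) by metis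
  qed
  then show "q \<in> tail_ultrafilters"
    using q(1) unfolding tail_ultrafilters_def sc_basic_def sc_points_def by blast
qed

text \<open>This is where \<open>shifts\<close> behaves like a semigroup: a product of a shift and a sufficiently
  late one is again a shift.\<close>

lemma limit_set_trans:
  assumes p: "ultrafilter_on E p" and q: "q \<in> limit_set p"
  shows "limit_set q \<subseteq> limit_set p"
proof
  fix r assume r: "r \<in> limit_set q"
  have uq: "ultrafilter_on E q"
    using q mem_limit_set_iff[OF p] by blast
  have "\<exists>h\<in>shifts m. P \<in> sc_action \<phi> h p" if "P \<in> r" for m P
  proof -
    obtain h where h: "h \<in> shifts m" "P \<in> sc_action \<phi> h q"
      using r mem_limit_set_iff[OF uq] \<open>P \<in> r\<close> by blast
    have hG: "h \<in> carrier G"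
      using h(1) shifts_subset by blast
    obtain l where l: "\<And>k. k \<in> shifts l \<Longrightarrow> h \<otimes> k \<in> shifts m"
      by (rule shifts_mult[OF h(1)]) blast
    obtain Q where Q: "P = \<phi> h ` Q" "Q \<in> q"
      using h(2) unfolding sc_action_def by blast
    then obtain k where k: "k \<in> shifts l" "Q \<in> sc_action \<phi> k p"
      using q mem_limit_set_iff[OF p] by blast
    then have "P \<in> sc_action \<phi> h (sc_action \<phi> k p)"
      using Q(1) unfolding sc_action_def by blast
    then have "P \<in> sc_action \<phi> (h \<otimes> k) p"
      using sc_action_mult[OF p hG] k(1) shifts_subset by blast
    then show ?thesis
      using l[OF k(1)] by blast
  qed
  then show "r \<in> limit_set p"
    using r mem_limit_set_iff[OF p] mem_limit_set_iff[OF uq] by blast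
qed

lemma shift_moves_tail_ultrafilter:
  assumes p: "p \<in> tail_ultrafilters" and h: "h \<in> shifts m"
  shows "sc_action \<phi> h p \<noteq> p"
proof
  assume eq: "sc_action \<phi> h p = p"
  obtain l where l: "\<phi> h ` tail l \<subseteq> tail m" "\<phi> h ` tail l \<inter> tail l = {}"
    by (rule shifts_tail[OF h])
  have "\<phi> h ` tail l \<in> sc_action \<phi> h p"
    using tail_ultrafiltersD(2)[OF p] unfolding sc_action_def by blast
  then show False
    using l(2) ultrafilter_disjoint[OF tail_ultrafiltersD(1)[OF p]] tail_ultrafiltersD(2)[OF p] eq
    by metis
qed

text \<open>A recurrent point of the system is a limit of its own shifts, all of them different from it.
  It is free because the tails have empty intersection.\<close>

lemma exists_nondiscrete_orbit:
  obtains p where "p \<in> sc_star E (\<Union>n. shifted_FP_block G \<phi> g x n)"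
    and "\<not> discrete_subspace (stone_cech E) (orbit G (sc_action \<phi>) p)"
proof -
  have "closedin (stone_cech E) tail_ultrafilters"
    unfolding tail_ultrafilters_def
    by (rule closedin_Inter) (use closedin_sc_basic[OF tail_subset] in auto)
  moreover have "closedin (stone_cech E) (limit_set p)" for p
    unfolding limit_set_def by (rule closedin_Inter) auto
  ultimately obtain p where p: "p \<in> tail_ultrafilters" "p \<in> limit_set p"
    by (rule recurrent_point_exists[OF compact_space_stone_cech _ tail_ultrafilters_nonempty])
      (rule limit_set_nonempty limit_set_subset limit_set_trans tail_ultrafiltersD(1) | assumption)+
  note up = tail_ultrafiltersD[OF p(1)]
  have "\<not> discrete_subspace (stone_cech E) (orbit G (sc_action \<phi>) p)"
  proof
    assume "discrete_subspace (stone_cech E) (orbit G (sc_action \<phi>) p)"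
    then obtain P where P: "P \<in> p"
      "\<And>h. h \<in> carrier G \<Longrightarrow> P \<in> sc_action \<phi> h p \<Longrightarrow> sc_action \<phi> h p = p"
      using discrete_orbit_iff_isolated[OF up(1)] by blast
    obtain h where "h \<in> shifts 0" "P \<in> sc_action \<phi> h p"
      using p(2) mem_limit_set_iff[OF up(1)] P(1) by blast
    then show False
      using P(2) shift_moves_tail_ultrafilter[OF p(1)] shifts_subset by blast
  qed
  moreover have "p \<in> sc_star E (\<Union>n. shifted_FP_block G \<phi> g x n)"
  proof -
    have "(\<Union>n. shifted_FP_block G \<phi> g x n) \<subseteq> E"
      unfolding shifted_FP_block_def using word_carrier x_in element_image by blast
    then have "(\<Union>n. shifted_FP_block G \<phi> g x n) \<in> p"
      using ultrafilter_mono[OF up(1) up(2) tail_0_subset] by blast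
    moreover have "p \<noteq> principal_ultrafilter E y" for y
      using up(2) Inter_tail unfolding principal_ultrafilter_def by blast
    ultimately show ?thesis
      using up(1) unfolding sc_star_def sc_basic_def sc_remainder_def sc_points_def by blast
  qed
  ultimately show ?thesis
    using that by blast
qed

end

section \<open>From an orbit that is not discrete to a piecewise shifted FP-set\<close>

context group_action
begin

text \<open>A nested sequence of sets, each carrying two disjoint copies of the next one (itself and its
  shift), is a Cantor scheme: the exponents say in which copy one descends. Leaving out \<open>x n\<close>
  at stage \<open>n\<close> keeps the later blocks away from the \<open>n\<close>-th one.\<close>

lemma piecewise_shifted_FP_set_if_nested:
  assumes g: "range g \<subseteq> carrier G"
    and P: "\<And>n. P n \<subseteq> E" and x: "\<And>n. x n \<in> P n"
    and nested: "\<And>n. P (Suc n) \<subseteq> P n - {x n}"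
    and shift: "\<And>n. \<phi> (g (Suc n)) ` P (Suc n) \<subseteq> P n - {x n}"
    and split: "\<And>n. P n \<inter> \<phi> (g n) ` P n = {}"
  shows "piecewise_shifted_FP_set G E \<phi> (\<Union>n. shifted_FP_block G \<phi> g x n)"
    and "(\<Union>n. shifted_FP_block G \<phi> g x n) \<subseteq> P 0 \<union> \<phi> (g 0) ` P 0"
proof -
  interpret group G by (rule group_G)
  have gc: "g n \<in> carrier G" for n
    using g by blast
  have pow: "\<phi> (g n [^] e) z = (if e = 0 then z else \<phi> (g n) z)"
    if "z \<in> E" "e \<in> {0, 1}" for n z and e :: nat
    using that gc action_one by auto
  \<comment> \<open>Absorbing the last letter into the point is what makes inductions on \<open>n\<close> work, since ordered
    products grow on the right, next to the point.\<close>
  have peel: "\<phi> (ordered_prod G g \<epsilon> (Suc n)) z =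
      \<phi> (ordered_prod G g \<epsilon> n) (if \<epsilon> (Suc n) = 0 then z else \<phi> (g (Suc n)) z)"
    if "z \<in> E" "\<epsilon> (Suc n) \<in> {0, 1}" for \<epsilon> n z
    using composition_rule[OF that(1) ordered_prod_closed[OF g]] gc pow[OF that] by simp
  have down: "(if e = 0 then z else \<phi> (g (Suc n)) z) \<in> P n - {x n}"
    if "z \<in> P (Suc n)" for n z and e :: nat
    using nested[of n] shift[of n] that by auto
  have stage: "e = d \<and> z = w"
    if "z \<in> P n" "w \<in> P n" "e \<in> {0, 1}" "d \<in> {0, 1}"
      and "(if e = 0 then z else \<phi> (g n) z) = (if d = 0 then w else \<phi> (g n) w)"
    for n z w and e d :: nat
  proof -
    have "z = w" if "\<phi> (g n) z = \<phi> (g n) w"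
      using inj_onD[OF inj_prop[OF gc] that] \<open>z \<in> P n\<close> \<open>w \<in> P n\<close> P by blast
    moreover have "z \<noteq> \<phi> (g n) w" "\<phi> (g n) z \<noteq> w"
      using split[of n] \<open>z \<in> P n\<close> \<open>w \<in> P n\<close> by blast+
    ultimately show ?thesis
      using that(3-5) by (auto split: if_splits)
  qed
  have inj: "(\<forall>i\<le>n. \<epsilon> i = \<delta> i) \<and> z = w"
    if "\<forall>i\<le>n. \<epsilon> i \<in> {0, 1}" "\<forall>i\<le>n. \<delta> i \<in> {0, 1}" "z \<in> P n" "w \<in> P n"
      and "\<phi> (ordered_prod G g \<epsilon> n) z = \<phi> (ordered_prod G g \<delta> n) w"
    for n \<epsilon> \<delta> z w
    using that
  proof (induction n arbitrary: z w)
    case 0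
    then have "\<epsilon> 0 = \<delta> 0 \<and> z = w"
      using P[of 0] by (intro stage[of _ 0]) (auto simp: pow subset_iff)
    then show ?case
      by simp
  next
    case (Suc n)
    let ?z = "if \<epsilon> (Suc n) = 0 then z else \<phi> (g (Suc n)) z"
    let ?w = "if \<delta> (Suc n) = 0 then w else \<phi> (g (Suc n)) w"
    have "z \<in> E" "w \<in> E"
      using Suc.prems(3,4) P by blast+
    moreover have "\<epsilon> (Suc n) \<in> {0, 1}" "\<delta> (Suc n) \<in> {0, 1}"
      using Suc.prems(1,2) by blast+
    ultimately have "\<phi> (ordered_prod G g \<epsilon> n) ?z = \<phi> (ordered_prod G g \<delta> n) ?w"
      using Suc.prems(5) by (simp only: peel)
    moreover have "?z \<in> P n" "?w \<in> P n"
      using down Suc.prems(3,4) by blast+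
    ultimately have IH: "(\<forall>i\<le>n. \<epsilon> i = \<delta> i) \<and> ?z = ?w"
      using Suc.prems(1,2) by (intro Suc.IH) auto
    then have "\<epsilon> (Suc n) = \<delta> (Suc n) \<and> z = w"
      using Suc.prems by (intro stage[of _ "Suc n"]) auto
    with IH show ?case
      by (simp add: le_Suc_eq)
  qed
  \<comment> \<open>A point of a later block, read with only the first letters, starts from a point that is not
    the one used for the earlier block.\<close>
  have descend: "\<exists>w\<in>P m - {x m}. \<phi> (ordered_prod G g \<epsilon> n) z = \<phi> (ordered_prod G g \<epsilon> m) w"
    if "m < n" "\<forall>i\<le>n. \<epsilon> i \<in> {0, 1}" "z \<in> P n" for m n \<epsilon> z
    using that
  proof (induction n arbitrary: z)
    case (Suc n)
    let ?z = "if \<epsilon> (Suc n) = 0 then z else \<phi> (g (Suc n)) z"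
    have z: "?z \<in> P n - {x n}"
      using down[OF Suc.prems(3)] .
    have "z \<in> E" "\<epsilon> (Suc n) \<in> {0, 1}"
      using Suc.prems(2,3) P by blast+
    then have eq: "\<phi> (ordered_prod G g \<epsilon> (Suc n)) z = \<phi> (ordered_prod G g \<epsilon> n) ?z"
      by (rule peel)
    show ?case
    proof (cases "m = n")
      case True
      then show ?thesis
        using z eq by blast
    next
      case False
      then have "\<exists>w\<in>P m - {x m}. \<phi> (ordered_prod G g \<epsilon> n) ?z = \<phi> (ordered_prod G g \<epsilon> m) w"
        using Suc.prems z by (intro Suc.IH) auto
      then show ?thesis
        using eq by simp
    qed
  qed simp
  have disj: "shifted_FP_block G \<phi> g x m \<inter> shifted_FP_block G \<phi> g x n = {}" if "m < n" for m n
  proof -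
    have False
      if \<delta>: "\<forall>i\<le>m. \<delta> i \<in> {0, 1}" and \<epsilon>: "\<forall>i\<le>n. \<epsilon> i \<in> {0, 1}"
        and eq: "\<phi> (ordered_prod G g \<delta> m) (x m) = \<phi> (ordered_prod G g \<epsilon> n) (x n)" for \<delta> \<epsilon>
    proof -
      obtain w where w: "w \<in> P m - {x m}"
        "\<phi> (ordered_prod G g \<epsilon> n) (x n) = \<phi> (ordered_prod G g \<epsilon> m) w"
        using descend[OF \<open>m < n\<close> \<epsilon> x] by (elim bexE)
      have "\<forall>i\<le>m. \<epsilon> i \<in> {0, 1}"
        using \<epsilon> \<open>m < n\<close> by (meson less_imp_le order_trans)
      moreover have "w \<in> P m"
        using w(1) by blast
      ultimately have "x m = w"
        using inj[OF \<delta> _ x _ trans[OF eq w(2)]] by blast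
      then show False
        using w(1) by blast
    qed
    then show ?thesis
      unfolding shifted_FP_block_def by blast
  qed
  have card: "card (shifted_FP_block G \<phi> g x n) = 2 ^ (n + 1)" for n
  proof -
    have "inj_on (\<lambda>\<epsilon>. \<phi> (ordered_prod G g \<epsilon> n) (x n)) ({..n} \<rightarrow>\<^sub>E {0, 1})"
    proof (rule inj_onI)
      fix \<epsilon> \<delta> assume ed: "\<epsilon> \<in> {..n} \<rightarrow>\<^sub>E {0, 1}" "\<delta> \<in> {..n} \<rightarrow>\<^sub>E {0, 1}"
        and eq: "\<phi> (ordered_prod G g \<epsilon> n) (x n) = \<phi> (ordered_prod G g \<delta> n) (x n)"
      have "\<forall>i\<le>n. \<epsilon> i \<in> {0, 1}" "\<forall>i\<le>n. \<delta> i \<in> {0, 1}"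
        using PiE_mem[OF ed(1)] PiE_mem[OF ed(2)] by simp_all
      from inj[OF this x x eq] have "\<forall>i\<le>n. \<epsilon> i = \<delta> i"
        by simp
      then show "\<epsilon> = \<delta>"
        using PiE_ext[OF ed] by simp
    qed
    then show ?thesis
      unfolding shifted_FP_block_eq_image by (simp only: card_image card_binary_words)
  qed
  have "m \<noteq> n \<Longrightarrow> shifted_FP_block G \<phi> g x m \<inter> shifted_FP_block G \<phi> g x n = {}" for m n
    using disj[of m n] disj[of n m] by (cases m n rule: linorder_cases) auto
  moreover have "range x \<subseteq> E"
    using x P by blast
  ultimately show "piecewise_shifted_FP_set G E \<phi> (\<Union>n. shifted_FP_block G \<phi> g x n)"
    using g card unfolding piecewise_shifted_FP_set_def by blast
  have "\<phi> (ordered_prod G g \<epsilon> n) (x n) \<in> P 0 \<union> \<phi> (g 0) ` P 0" if e: "\<forall>i\<le>n. \<epsilon> i \<in> {0, 1}" for n \<epsilon>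
  proof -
    obtain w where w: "w \<in> P 0" "\<phi> (ordered_prod G g \<epsilon> n) (x n) = \<phi> (ordered_prod G g \<epsilon> 0) w"
      using descend[of 0 n \<epsilon> "x n"] e x by (cases "n = 0") auto
    have "w \<in> E" "\<epsilon> 0 \<in> {0, 1}"
      using w(1) P e by blast+
    then show ?thesis
      using pow[of w "\<epsilon> 0" 0] w by (auto split: if_splits)
  qed
  then show "(\<Union>n. shifted_FP_block G \<phi> g x n) \<subseteq> P 0 \<union> \<phi> (g 0) ` P 0"
    unfolding shifted_FP_block_def by blast
qed

text \<open>Some \<open>g p \<noteq> p\<close> contains \<open>Q\<close>. A set \<open>R\<close> that separates \<open>p\<close> from \<open>g p\<close> makes the two copies
  disjoint.\<close>

lemma splitting_if_not_isolated:
  assumes p: "ultrafilter_on E p"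
    and limit: "\<And>P. P \<in> p \<Longrightarrow> \<exists>g\<in>carrier G. P \<in> sc_action \<phi> g p \<and> sc_action \<phi> g p \<noteq> p"
    and Q: "Q \<in> p"
  obtains g P where "g \<in> carrier G" "P \<in> p" "P \<subseteq> Q" "\<phi> g ` P \<subseteq> Q" "P \<inter> \<phi> g ` P = {}"
proof -
  obtain g where g: "g \<in> carrier G" "Q \<in> sc_action \<phi> g p" "sc_action \<phi> g p \<noteq> p"
    using limit[OF Q] by blast
  note ug = ultrafilter_on_sc_action[OF p g(1)]
  obtain R where R: "R \<in> p" "R \<notin> sc_action \<phi> g p"
    using ultrafilter_eqI[OF p ug] g(3) by blast
  have "E - R \<in> sc_action \<phi> g p"
    using R ultrafilter_Diff_iff[OF ug] ultrafilter_subset[OF p] by blast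
  then have "Q \<inter> (E - R) \<in> sc_action \<phi> g p"
    using ultrafilter_Int[OF ug] g(2) by blast
  then have "{z \<in> E. \<phi> g z \<in> Q \<inter> (E - R)} \<in> p"
    using mem_sc_action_iff[OF p g(1)] by blast
  then have "Q \<inter> R \<inter> {z \<in> E. \<phi> g z \<in> Q \<inter> (E - R)} \<in> p" (is "?P \<in> p")
    using ultrafilter_Int[OF p] Q R(1) by blast
  moreover have "?P \<inter> \<phi> g ` ?P = {}"
    by blast
  ultimately show ?thesis
    using that[of g ?P] g(1) by blast
qed

lemma exists_piecewise_shifted_FP_set:
  assumes p: "p \<in> sc_star E A"
    and nd: "\<not> discrete_subspace (stone_cech E) (orbit G (sc_action \<phi>) p)"
  obtains Y where "piecewise_shifted_FP_set G E \<phi> Y" and "Y \<subseteq> A"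
proof -
  have up: "ultrafilter_on E p" and Ap: "A \<in> p" and free: "p \<notin> principal_ultrafilter E ` E"
    using p unfolding sc_star_def sc_basic_def sc_remainder_def sc_points_def by blast+
  have limit: "\<exists>g\<in>carrier G. P \<in> sc_action \<phi> g p \<and> sc_action \<phi> g p \<noteq> p" if "P \<in> p" for P
    using nd that unfolding discrete_orbit_iff_isolated[OF up] by blast
  \<comment> \<open>A stage is a shift, a set and the point that the next stage has to avoid.\<close>
  define ok where "ok = (\<lambda>(g, P, y) Q. g \<in> carrier G \<and> P \<in> p \<and> y \<in> P \<and> P \<subseteq> Q \<and>
      \<phi> g ` P \<subseteq> Q \<and> P \<inter> \<phi> g ` P = {})"
  have step: "\<exists>s. ok s Q" if Q: "Q \<in> p" for Q
  proof -
    obtain g P where gP: "g \<in> carrier G" "P \<in> p" "P \<subseteq> Q" "\<phi> g ` P \<subseteq> Q" "P \<inter> \<phi> g ` P = {}"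
      by (rule splitting_if_not_isolated[OF up limit Q])
    then obtain y where "y \<in> P"
      using ultrafilter_nonempty[OF up] by blast
    with gP have "ok (g, P, y) Q"
      by (simp add: ok_def)
    then show ?thesis ..
  qed
  have "\<exists>f. \<forall>n. (fst (snd (f n)) \<in> p \<and> (n = 0 \<longrightarrow> ok (f n) A)) \<and>
      ok (f (Suc n)) (fst (snd (f n)) - {snd (snd (f n))})"
  proof (rule dependent_nat_choice)
    show "\<exists>s. fst (snd s) \<in> p \<and> ((0::nat) = 0 \<longrightarrow> ok s A)"
      using step[OF Ap] unfolding ok_def by auto
  next
    fix s and n :: nat assume "fst (snd s) \<in> p \<and> (n = 0 \<longrightarrow> ok s A)"
    then have "fst (snd s) - {snd (snd s)} \<in> p"
      using nonprincipal_ultrafilter_Diff_singleton[OF up free] by blast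
    then obtain t where "ok t (fst (snd s) - {snd (snd s)})"
      using step by blast
    then show "\<exists>t. (fst (snd t) \<in> p \<and> (Suc n = 0 \<longrightarrow> ok t A)) \<and> ok t (fst (snd s) - {snd (snd s)})"
      unfolding ok_def by auto
  qed
  then obtain f where f0: "ok (f 0) A"
    and fSuc: "\<And>n. ok (f (Suc n)) (fst (snd (f n)) - {snd (snd (f n))})"
    by blast
  define g where "g n = fst (f n)" for n
  define P where "P n = fst (snd (f n))" for n
  define x where "x n = snd (snd (f n))" for n
  have ok0: "ok (g 0, P 0, x 0) A" and okSuc: "ok (g (Suc n), P (Suc n), x (Suc n)) (P n - {x n})" for n
    using f0 fSuc unfolding g_def P_def x_def by simp_all
  have ok: "\<exists>Q. ok (g n, P n, x n) Q" for n
    using ok0 okSuc by (cases n) blast+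
  have 1: "range g \<subseteq> carrier G" and 2: "\<And>n. P n \<subseteq> E" and 3: "\<And>n. x n \<in> P n"
    and 4: "\<And>n. P n \<inter> \<phi> (g n) ` P n = {}"
    using ok ultrafilter_subset[OF up] unfolding ok_def by auto
  have 5: "\<And>n. P (Suc n) \<subseteq> P n - {x n}" and 6: "\<And>n. \<phi> (g (Suc n)) ` P (Suc n) \<subseteq> P n - {x n}"
    using okSuc unfolding ok_def by auto
  have "P 0 \<union> \<phi> (g 0) ` P 0 \<subseteq> A"
    using ok0 unfolding ok_def by blast
  then show ?thesis
    using that piecewise_shifted_FP_set_if_nested[of g P x, OF 1 2 3 5 6 4] by blast
qed

end

section \<open>The characterization\<close>

theorem theorem4p4:
  fixes G :: "('g, 'm) monoid_scheme"
    and X A :: "'x set"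
    and \<phi> :: "'g \<Rightarrow> 'x \<Rightarrow> 'x"
  assumes "transitive_action G X \<phi>"
    and "infinite X"
    and "A \<subseteq> X"
    and "infinite A"
  shows "(\<forall>p \<in> sc_star X A. discrete_subspace (stone_cech X) (orbit G (sc_action \<phi>) p))
     \<longleftrightarrow> \<not> (\<exists>Y. piecewise_shifted_FP_set G X \<phi> Y \<and> Y \<subseteq> A)"
proof -
  interpret group_action G X \<phi>
    using assms(1) by (simp add: transitive_action_def)
  show ?thesis
  proof
    assume discrete: "\<forall>p \<in> sc_star X A. discrete_subspace (stone_cech X) (orbit G (sc_action \<phi>) p)"
    show "\<not> (\<exists>Y. piecewise_shifted_FP_set G X \<phi> Y \<and> Y \<subseteq> A)"
    proof
      assume "\<exists>Y. piecewise_shifted_FP_set G X \<phi> Y \<and> Y \<subseteq> A"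
      then obtain Y where "piecewise_shifted_FP_set G X \<phi> Y" "Y \<subseteq> A"
        by blast
      then obtain g x where gx: "range g \<subseteq> carrier G" "range x \<subseteq> X"
        "\<forall>m n. m \<noteq> n \<longrightarrow> shifted_FP_block G \<phi> g x m \<inter> shifted_FP_block G \<phi> g x n = {}"
        "\<forall>n. card (shifted_FP_block G \<phi> g x n) = 2 ^ (n + 1)"
        and sub: "(\<Union>n. shifted_FP_block G \<phi> g x n) \<subseteq> A"
        unfolding piecewise_shifted_FP_set_def by (elim exE conjE) simp
      interpret shifted_FP_system G X \<phi> g x
        using gx by unfold_locales auto
      obtain p where p: "p \<in> sc_star X (\<Union>n. shifted_FP_block G \<phi> g x n)"
        "\<not> discrete_subspace (stone_cech X) (orbit G (sc_action \<phi>) p)"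
        by (rule exists_nondiscrete_orbit)
      then have "A \<in> p"
        using ultrafilter_mono[OF _ _ sub assms(3)] by (simp add: sc_star_def sc_basic_def sc_points_def)
      then have "p \<in> sc_star X A"
        using p(1) by (simp add: sc_star_def sc_basic_def)
      then show False
        using discrete p(2) by blast
    qed
  next
    assume "\<not> (\<exists>Y. piecewise_shifted_FP_set G X \<phi> Y \<and> Y \<subseteq> A)"
    then show "\<forall>p \<in> sc_star X A. discrete_subspace (stone_cech X) (orbit G (sc_action \<phi>) p)"
      using exists_piecewise_shifted_FP_set by metis
  qed
qed

end
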